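(* Let $(J_n)_{n\ge 0}$ be the Jacobsthal numbers and, for $n\ge 0$, let $$HSJ_n=\begin{bmatrix} J_n+jJ_{n+3}\\ -J_{n+1}+jJ_{n+2}\end{bmatrix}.$$ Then: (1) for all integers $n\ge 0$ and $t\ge 0$, $\displaystyle\sum_{s=0}^{t} HSJ_{n+s}=\frac12\left(HSJ_{n+t+2}-HSJ_{n+1}\right)$; (2) for all integers $n\ge 1$, $\displaystyle\sum_{s=1}^{n} HSJ_{s}=\frac12\left(HSJ_{n+2}-HSJ_{2}\right)$.
   Context: The Jacobsthal numbers are defined by $J_0=0$, $J_1=1$, $J_{n+2}=J_{n+1}+2J_n$. Here $j$ is the hyperbolic unit ($j^2=1$, $j\neq\pm1$); spinors are column vectors with two hyperbolic-number entries, added and multiplied by real scalars componentwise. *)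

theory Defs
  imports "HOL-Analysis.Analysis"
begin

fun jacobsthal :: "nat \<Rightarrow> nat" where
  "jacobsthal 0 = 0"
| "jacobsthal (Suc 0) = 1"
| "jacobsthal (Suc (Suc n)) = jacobsthal (Suc n) + 2 * jacobsthal n"

text \<open>\<open>Hyperbolic a b\<close> stands for the hyperbolic (split-complex) number \<open>a + j b\<close>, where \<open>j\<^sup>2 = 1\<close>.\<close>

datatype hyperbolic = Hyperbolic (hre: real) (him: real)

instantiation hyperbolic :: comm_ring_1
begin

definition zero_hyperbolic :: hyperbolic
  where "0 = Hyperbolic 0 0"

definition one_hyperbolic :: hyperbolic
  where "1 = Hyperbolic 1 0"

definition plus_hyperbolic :: "hyperbolic \<Rightarrow> hyperbolic \<Rightarrow> hyperbolic"
  where "x + y = Hyperbolic (hre x + hre y) (him x + him y)"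

definition uminus_hyperbolic :: "hyperbolic \<Rightarrow> hyperbolic"
  where "- x = Hyperbolic (- hre x) (- him x)"

definition minus_hyperbolic :: "hyperbolic \<Rightarrow> hyperbolic \<Rightarrow> hyperbolic"
  where "x - y = Hyperbolic (hre x - hre y) (him x - him y)"

definition times_hyperbolic :: "hyperbolic \<Rightarrow> hyperbolic \<Rightarrow> hyperbolic"
  where "x * y = Hyperbolic (hre x * hre y + him x * him y) (hre x * him y + him x * hre y)"

instance
  by standard
    (auto simp: zero_hyperbolic_def one_hyperbolic_def plus_hyperbolic_def uminus_hyperbolic_def
      minus_hyperbolic_def times_hyperbolic_def algebra_simps)

end

instantiation hyperbolic :: real_algebra_1
begin

definition scaleR_hyperbolic :: "real \<Rightarrow> hyperbolic \<Rightarrow> hyperbolic"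
  where "r *\<^sub>R x = Hyperbolic (r * hre x) (r * him x)"

instance
  by standard
    (auto simp: scaleR_hyperbolic_def plus_hyperbolic_def times_hyperbolic_def algebra_simps)

end

definition hyp_j :: hyperbolic
  where "hyp_j = Hyperbolic 0 1"

lemma hyp_j_square: "hyp_j\<^sup>2 = 1"
  by (simp add: power2_eq_square hyp_j_def times_hyperbolic_def one_hyperbolic_def)

lemma hyp_j_neq: "hyp_j \<noteq> 1" "hyp_j \<noteq> - 1"
  by (simp_all add: hyp_j_def one_hyperbolic_def uminus_hyperbolic_def)

lemma Hyperbolic_eq: "Hyperbolic a b = of_real a + hyp_j * of_real b"
  by (simp add: hyp_j_def of_real_def scaleR_hyperbolic_def one_hyperbolic_def
      plus_hyperbolic_def times_hyperbolic_def)

type_synonym hyp_spinor = "hyperbolic ^ 2"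

definition HSJ :: "nat \<Rightarrow> hyp_spinor"
  where "HSJ n = vector
    [of_nat (jacobsthal n) + hyp_j * of_nat (jacobsthal (n + 3)),
     - of_nat (jacobsthal (n + 1)) + hyp_j * of_nat (jacobsthal (n + 2))]"

end

theory Submission
  imports Defs
begin

text \<open>The Jacobsthal recurrence is linear, so the spinors inherit it (\<open>HSJ_rec\<close>).
  Solved for its last term, it makes each \<open>HSJ s\<close> half of a difference of consecutive
  spinors, and the sum over any interval telescopes (\<open>sum_HSJ\<close>). Both claims are
  instances of that interval sum.\<close>

text \<open>Real coordinates let the spinor operations be computed directly from their componentwise
  definitions.\<close>

lemma HSJ_eq_Hyperbolic:
  "HSJ n = vector
    [Hyperbolic (real (jacobsthal n)) (real (jacobsthal (n + 3))),
     Hyperbolic (- real (jacobsthal (n + 1))) (real (jacobsthal (n + 2)))]"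
  by (simp only: HSJ_def Hyperbolic_eq of_real_of_nat_eq of_real_minus)

text \<open>All four real coordinates are, up to sign, shifts of the Jacobsthal sequence, so each
  satisfies its recurrence.\<close>

lemma HSJ_rec: "HSJ (Suc (Suc n)) = HSJ (Suc n) + 2 *\<^sub>R HSJ n"
  unfolding vec_eq_iff forall_2
  by (simp only: HSJ_eq_Hyperbolic vector_2 vector_add_component vector_scaleR_component
      plus_hyperbolic_def scaleR_hyperbolic_def hyperbolic.sel hyperbolic.inject
      numeral_3_eq_3 add_2_eq_Suc' One_nat_def add_Suc_right add_0_right
      jacobsthal.simps of_nat_add of_nat_mult)
    simp

text \<open>The bound admits the empty interval \<open>m = Suc n\<close>, where both sides
  vanish.\<close>

lemma sum_HSJ:
  assumes "m \<le> Suc n"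
  shows "(\<Sum>s = m..n. HSJ s) = (1 / 2 :: real) *\<^sub>R (HSJ (n + 2) - HSJ (m + 1))"
proof -
  have "(\<Sum>s = m..n. HSJ s) = (1 / 2 :: real) *\<^sub>R (\<Sum>s = m..n. HSJ (Suc (Suc s)) - HSJ (Suc s))"
    \<comment> \<open>Each difference is \<open>2 *\<^sub>R HSJ s\<close>; the factor 2 leaves the
      sum and cancels 1/2.\<close>
    by (simp add: HSJ_rec flip: scaleR_sum_right)
  also have "(\<Sum>s = m..n. HSJ (Suc (Suc s)) - HSJ (Suc s)) = HSJ (n + 2) - HSJ (m + 1)"
    using sum_Suc_diff[OF assms, of "\<lambda>s. HSJ (Suc s)"] by simp
  finally show ?thesis .
qed

theorem theorem3p4:
  "(\<forall>n t :: nat. (\<Sum>s = 0..t. HSJ (n + s)) = (1 / 2 :: real) *\<^sub>R (HSJ (n + t + 2) - HSJ (n + 1))) \<and>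
   (\<forall>n :: nat. n \<ge> 1 \<longrightarrow> (\<Sum>s = 1..n. HSJ s) = (1 / 2 :: real) *\<^sub>R (HSJ (n + 2) - HSJ 2))"
proof (intro conjI allI impI)
  fix n t :: nat
  \<comment> \<open>Shifting the index by \<open>n\<close> gives the interval form of
    \<open>sum_HSJ\<close>.\<close>
  have "(\<Sum>s = 0..t. HSJ (n + s)) = (\<Sum>s = n..n + t. HSJ s)"
    using sum.shift_bounds_cl_nat_ivl[of HSJ 0 n t] by (simp add: add.commute)
  then show "(\<Sum>s = 0..t. HSJ (n + s)) = (1 / 2 :: real) *\<^sub>R (HSJ (n + t + 2) - HSJ (n + 1))"
    by (simp only: sum_HSJ[of n "n + t"] le_SucI le_add1)
next
  fix n :: nat
  show "(\<Sum>s = 1..n. HSJ s) = (1 / 2 :: real) *\<^sub>R (HSJ (n + 2) - HSJ 2)"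
    using sum_HSJ[of 1 n, unfolded one_add_one] by simp
qed

end
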